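(* Let $G$ and $H$ be compact Lie groups, let $R$ be a commutative ring with unit, let $\phi\colon G\to H$ be a continuous homomorphism, let $X$ be a path-connected $G$-space, and let $Y$ be a path-connected $H$-space. For $2\le r\le\infty$ put $$\mathcal{S}_{\phi,R}^{(r)}(Y_H,X_G)=\left\{\ell\in\mathcal{I}_r^H(Y;R)\ ;\ (B\phi)^*\ell\notin\mathcal{I}_r^G(X;R)\right\},$$ where $(B\phi)^*\colon H^*(BH;R)\to H^*(BG;R)$ is the homomorphism induced by $\phi$. If $\mathcal{S}_{\phi,R}^{(r)}(Y_H,X_G)\neq\emptyset$ for some $2\le r\le\infty$, then there is no $\phi$-equivariant map $X\to Y$.
   Context: All actions of groups on spaces are continuous. A map $f\colon X\to Y$ from a $G$-space to an $H$-space is $\phi$-equivariant if it is continuous and $f(gx)=\phi(g)f(x)$ for all $g\in G$, $x\in X$. For a compact Lie group $K$ acting on a space $Z$, let $EK$ be a contractible free $K$-space, $BK=EK/K$, and $Z_K=(EK\times Z)/K$ the Borel construction. The projection $Z_K\to BK$ gives the Borel fibration $Z\to Z_K\to BK$. Let $E_r^{p,q}(Z_K;R)$ denote its cohomological Leray--Serre spectral sequence, with $E_2^{p,q}(Z_K;R)\cong H^p(BK;\mathcal{H}^q(Z;R))$ (local coefficients given by the action of $K$ on $H^q(Z;R)$). Standing assumption: the spaces considered are such that the Borel fibrations admit natural multiplicative Leray--Serre spectral sequences, and, whenever the page $r=\infty$ is used, these converge strongly to Borel cohomology $H_K^*(Z;R)=H^*(Z_K;R)$. (This holds e.g. for finite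 equivariant CW complexes.) When $Z$ is path connected, $E_2^{*,0}(Z_K;R)=H^*(BK;R)$ canonically. Since no differential leaves the bottom row (first-quadrant spectral sequence), there are canonical quotient maps $E_r^{*,0}(Z_K;R)\to E_s^{*,0}(Z_K;R)$ for $2\le r\le s\le\infty$, and in particular a homomorphism $\rho_r^{K,Z}\colon H^*(BK;R)\to E_r^{*,0}(Z_K;R)$. For $2\le r\le\infty$ the $r$-th partial Borel index of a path-connected $K$-space $Z$ is the homogeneous ideal $$\mathcal{I}_r^K(Z;R)=\ker\bigl(\rho_r^{K,Z}\colon H^*(BK;R)\to E_r^{*,0}(Z_K;R)\bigr).$$ *)

theory Defs
  imports "HOL-Homology.Homology" "HOL-Analysis.Analysis" "HOL-Algebra.Group_Action"
    "HOL-Library.Function_Algebras" "HOL-Library.Set_Algebras" "HOL-Library.Extended_Nat"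
begin

section \<open>Compact Lie groups\<close>

text \<open>
  The library has no smooth manifolds.  Charts take values in open subsets of
  \<^const>\<open>Euclidean_space\<close> of dimension n, where the dimension 0 is allowed, so that finite groups
  are Lie groups.  A function on an open subset U of R^m is of class C^(k+1) if it is continuous and
  its partial derivatives exist on U and are of class C^k.
\<close>

primrec Ck_on :: "nat \<Rightarrow> nat \<Rightarrow> (nat \<Rightarrow> real) set \<Rightarrow> ((nat \<Rightarrow> real) \<Rightarrow> real) \<Rightarrow> bool" where
  "Ck_on 0 m U f \<longleftrightarrow> continuous_map (subtopology (Euclidean_space m) U) euclideanreal f"
| "Ck_on (Suc k) m U f \<longleftrightarrow>
     continuous_map (subtopology (Euclidean_space m) U) euclideanreal f \<and>
     (\<forall>i<m. (\<forall>x\<in>U. (\<lambda>t. f (x(i := t))) differentiable (at (x i))) \<and>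
            Ck_on k m U (\<lambda>x. deriv (\<lambda>t. f (x(i := t))) (x i)))"

definition smooth_map ::
    "nat \<Rightarrow> nat \<Rightarrow> (nat \<Rightarrow> real) set \<Rightarrow> ((nat \<Rightarrow> real) \<Rightarrow> nat \<Rightarrow> real) \<Rightarrow> bool" where
  "smooth_map m n U f \<longleftrightarrow> (\<forall>k. \<forall>i<n. Ck_on k m U (\<lambda>x. f x i))"

definition smooth_atlas :: "nat \<Rightarrow> 'g topology \<Rightarrow> ('g set \<times> ('g \<Rightarrow> nat \<Rightarrow> real)) set \<Rightarrow> bool" where
  "smooth_atlas n T A \<longleftrightarrow>
     (\<forall>(U, \<psi>)\<in>A. openin T U \<and>
        (\<exists>V. openin (Euclidean_space n) V \<and>
             homeomorphic_map (subtopology T U) (subtopology (Euclidean_space n) V) \<psi>)) \<and>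
     (\<Union>(U, \<psi>)\<in>A. U) = topspace T \<and>
     (\<forall>(U, \<psi>)\<in>A. \<forall>(V, \<eta>)\<in>A. smooth_map n n (\<psi> ` (U \<inter> V)) (\<eta> \<circ> inv_into U \<psi>))"

text \<open>The two projections of R^(n+n) onto R^n, used to write multiplication in charts.\<close>

definition lower_half :: "nat \<Rightarrow> (nat \<Rightarrow> real) \<Rightarrow> nat \<Rightarrow> real" where
  "lower_half n z = (\<lambda>i. if i < n then z i else 0)"

definition upper_half :: "nat \<Rightarrow> (nat \<Rightarrow> real) \<Rightarrow> nat \<Rightarrow> real" where
  "upper_half n z = (\<lambda>i. if i < n then z (n + i) else 0)"

definition smooth_mult ::
    "nat \<Rightarrow> ('g set \<times> ('g \<Rightarrow> nat \<Rightarrow> real)) set \<Rightarrow> ('g \<Rightarrow> 'g \<Rightarrow> 'g) \<Rightarrow> bool" where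
  "smooth_mult n A f \<longleftrightarrow>
     (\<forall>(U, \<psi>)\<in>A. \<forall>(V, \<eta>)\<in>A. \<forall>(W, \<omega>)\<in>A.
        let m = (\<lambda>z. f (inv_into U \<psi> (lower_half n z)) (inv_into V \<eta> (upper_half n z)))
        in smooth_map (n + n) n
             {z \<in> topspace (Euclidean_space (n + n)).
                lower_half n z \<in> \<psi> ` U \<and> upper_half n z \<in> \<eta> ` V \<and> m z \<in> W}
             (\<omega> \<circ> m))"

definition smooth_inverse ::
    "nat \<Rightarrow> ('g set \<times> ('g \<Rightarrow> nat \<Rightarrow> real)) set \<Rightarrow> ('g \<Rightarrow> 'g) \<Rightarrow> bool" where
  "smooth_inverse n A f \<longleftrightarrow>
     (\<forall>(U, \<psi>)\<in>A. \<forall>(W, \<omega>)\<in>A. smooth_map n n (\<psi> ` {g \<in> U. f g \<in> W}) (\<omega> \<circ> f \<circ> inv_into U \<psi>))"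

definition compact_lie_group :: "'g monoid \<Rightarrow> 'g topology \<Rightarrow> bool" where
  "compact_lie_group G T \<longleftrightarrow>
     group G \<and> topspace T = carrier G \<and>
     continuous_map (prod_topology T T) T (\<lambda>(g, h). g \<otimes>\<^bsub>G\<^esub> h) \<and>
     continuous_map T T (\<lambda>g. inv\<^bsub>G\<^esub> g) \<and>
     Hausdorff_space T \<and> second_countable T \<and> compact_space T \<and>
     (\<exists>n A. smooth_atlas n T A \<and> smooth_mult n A (\<lambda>g h. g \<otimes>\<^bsub>G\<^esub> h) \<and>
            smooth_inverse n A (\<lambda>g. inv\<^bsub>G\<^esub> g))"


section \<open>Spaces with a group action\<close>

definition G_space :: "'g monoid \<Rightarrow> 'g topology \<Rightarrow> 'x topology \<Rightarrow> ('g \<Rightarrow> 'x \<Rightarrow> 'x) \<Rightarrow> bool" where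
  "G_space G T X a \<longleftrightarrow>
     group_action G (topspace X) a \<and> continuous_map (prod_topology T X) X (\<lambda>(g, x). a g x)"

definition equivariant_map ::
    "'g monoid \<Rightarrow> ('g \<Rightarrow> 'h) \<Rightarrow> 'x topology \<Rightarrow> ('g \<Rightarrow> 'x \<Rightarrow> 'x) \<Rightarrow> 'y topology \<Rightarrow> ('h \<Rightarrow> 'y \<Rightarrow> 'y) \<Rightarrow>
     ('x \<Rightarrow> 'y) \<Rightarrow> bool" where
  "equivariant_map G \<phi> X a Y b f \<longleftrightarrow>
     continuous_map X Y f \<and> (\<forall>g\<in>carrier G. \<forall>x\<in>topspace X. f (a g x) = b (\<phi> g) (f x))"

text \<open>The orbit space, with the quotient topology.\<close>

definition orbit_space :: "'g monoid \<Rightarrow> 'x topology \<Rightarrow> ('g \<Rightarrow> 'x \<Rightarrow> 'x) \<Rightarrow> 'x set topology" where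
  "orbit_space G X a =
     topology (\<lambda>U. U \<subseteq> orbits G (topspace X) a \<and> openin X {x \<in> topspace X. orbit G a x \<in> U})"

lemma openin_orbit_space:
  "openin (orbit_space G X a) U \<longleftrightarrow>
     U \<subseteq> orbits G (topspace X) a \<and> openin X {x \<in> topspace X. orbit G a x \<in> U}"
proof -
  have "istopology (\<lambda>U. U \<subseteq> orbits G (topspace X) a \<and> openin X {x \<in> topspace X. orbit G a x \<in> U})"
    unfolding istopology_def
  proof (intro conjI allI impI)
    fix S T
    assume S: "S \<subseteq> orbits G (topspace X) a \<and> openin X {x \<in> topspace X. orbit G a x \<in> S}"
      and T: "T \<subseteq> orbits G (topspace X) a \<and> openin X {x \<in> topspace X. orbit G a x \<in> T}"
    then show "S \<inter> T \<subseteq> orbits G (topspace X) a" by blast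
    have "{x \<in> topspace X. orbit G a x \<in> S \<inter> T} =
        {x \<in> topspace X. orbit G a x \<in> S} \<inter> {x \<in> topspace X. orbit G a x \<in> T}" by blast
    then show "openin X {x \<in> topspace X. orbit G a x \<in> S \<inter> T}" using S T by auto
  next
    fix K
    assume K: "\<forall>S\<in>K. S \<subseteq> orbits G (topspace X) a \<and> openin X {x \<in> topspace X. orbit G a x \<in> S}"
    then show "\<Union>K \<subseteq> orbits G (topspace X) a" by blast
    have "{x \<in> topspace X. orbit G a x \<in> \<Union>K} = (\<Union>S\<in>K. {x \<in> topspace X. orbit G a x \<in> S})" by blast
    then show "openin X {x \<in> topspace X. orbit G a x \<in> \<Union>K}" using K by auto
  qed
  then show ?thesis
    unfolding orbit_space_def by (simp only: topology_inverse')
qed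

lemma quotient_map_orbit_space: "quotient_map X (orbit_space G X a) (orbit G a)"
proof -
  have eq: "{x \<in> topspace X. orbit G a x \<in> orbits G (topspace X) a} = topspace X"
    by (auto simp: orbits_def)
  have "openin (orbit_space G X a) (orbits G (topspace X) a)"
    unfolding openin_orbit_space eq by simp
  then have "orbits G (topspace X) a \<subseteq> topspace (orbit_space G X a)"
    by (rule openin_subset)
  moreover have "topspace (orbit_space G X a) \<subseteq> orbits G (topspace X) a"
    using openin_topspace[of "orbit_space G X a"] unfolding openin_orbit_space by simp
  ultimately have top: "topspace (orbit_space G X a) = orbits G (topspace X) a"
    by (rule subset_antisym[rotated])
  have "orbit G a ` topspace X = orbits G (topspace X) a"
    by (auto simp: orbits_def)
  then show ?thesis
    unfolding quotient_map_def top openin_orbit_space by simp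
qed

text \<open>
  A contractible free K-space.  The library counts the empty space as contractible, hence the
  first condition.
\<close>

definition universal_space ::
    "'g monoid \<Rightarrow> 'g topology \<Rightarrow> 'e topology \<Rightarrow> ('g \<Rightarrow> 'e \<Rightarrow> 'e) \<Rightarrow> bool" where
  "universal_space K T E a \<longleftrightarrow>
     topspace E \<noteq> {} \<and> G_space K T E a \<and> contractible_space E \<and>
     (\<forall>g\<in>carrier K. \<forall>e\<in>topspace E. a g e = e \<longrightarrow> g = \<one>\<^bsub>K\<^esub>)"

definition borel_construction ::
    "'g monoid \<Rightarrow> 'e topology \<Rightarrow> ('g \<Rightarrow> 'e \<Rightarrow> 'e) \<Rightarrow> 'z topology \<Rightarrow> ('g \<Rightarrow> 'z \<Rightarrow> 'z) \<Rightarrow>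
     ('e \<times> 'z) set topology" where
  "borel_construction K E a Z b = orbit_space K (prod_topology E Z) (\<lambda>g. map_prod (a g) (b g))"

text \<open>The first projection maps the orbit of (e, z), as a set, onto the orbit of e.\<close>

definition borel_projection :: "('e \<times> 'z) set \<Rightarrow> 'e set" where
  "borel_projection c = fst ` c"

text \<open>
  For a \<phi>-equivariant map \<epsilon> from EG to EH, the induced map from BG to BH, which sends the orbit
  of e to the orbit of \<epsilon>(e).
\<close>

definition classifying_map ::
    "'h monoid \<Rightarrow> ('h \<Rightarrow> 'f \<Rightarrow> 'f) \<Rightarrow> ('e \<Rightarrow> 'f) \<Rightarrow> 'e set \<Rightarrow> 'f set" where
  "classifying_map H b \<epsilon> c = (\<Union>e\<in>c. orbit H b (\<epsilon> e))"


section \<open>Singular cohomology\<close>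

text \<open>
  Coefficients are taken in the additive group of a type.  A cochain of degree n is a function on all
  simplices that vanishes outside the singular n-simplices of the space, and a cohomology class is a
  coset of the group of coboundaries.  A commutative ring with unit, which may be the zero ring, is a
  type of sort \<open>{comm_ring, monoid_mult}\<close>; the class \<open>comm_ring_1\<close> would require \<open>0 \<noteq> 1\<close>.
\<close>

type_synonym ('a, 'r) cochain = "((nat \<Rightarrow> real) \<Rightarrow> 'a) \<Rightarrow> 'r"

type_synonym ('a, 'r) total_class = "nat \<Rightarrow> ('a, 'r) cochain set"

definition signed :: "nat \<Rightarrow> 'r::ab_group_add \<Rightarrow> 'r" where
  "signed i x = (if even i then x else - x)"

definition cochains :: "nat \<Rightarrow> 'a topology \<Rightarrow> ('a, 'r::ab_group_add) cochain set" where
  "cochains n X = {c. \<forall>\<sigma>. \<not> singular_simplex n X \<sigma> \<longrightarrow> c \<sigma> = 0}"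

definition coboundary ::
    "nat \<Rightarrow> 'a topology \<Rightarrow> ('a, 'r::ab_group_add) cochain \<Rightarrow> ('a, 'r) cochain" where
  "coboundary n X c =
     (\<lambda>\<sigma>. if singular_simplex (Suc n) X \<sigma>
          then \<Sum>i\<le>Suc n. signed i (c (singular_face (Suc n) i \<sigma>)) else 0)"

definition cocycles :: "nat \<Rightarrow> 'a topology \<Rightarrow> ('a, 'r::ab_group_add) cochain set" where
  "cocycles n X = {c \<in> cochains n X. coboundary n X c = 0}"

definition coboundaries :: "nat \<Rightarrow> 'a topology \<Rightarrow> ('a, 'r::ab_group_add) cochain set" where
  "coboundaries n X = (case n of 0 \<Rightarrow> {0} | Suc m \<Rightarrow> coboundary m X ` cochains m X)"

definition cohomology :: "nat \<Rightarrow> 'a topology \<Rightarrow> ('a, 'r::ab_group_add) cochain set set" where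
  "cohomology n X = (\<lambda>c. c +o coboundaries n X) ` cocycles n X"

text \<open>
  The direct sum of all cohomology groups; an element is the family of its homogeneous components.
  The zero class of degree n is the coset \<^term>\<open>coboundaries n X\<close>.
\<close>

definition total_cohomology :: "'a topology \<Rightarrow> ('a, 'r::ab_group_add) total_class set" where
  "total_cohomology X =
     {l. (\<forall>n. l n \<in> cohomology n X) \<and> finite {n. l n \<noteq> coboundaries n X}}"

definition cochain_pullback ::
    "nat \<Rightarrow> 'a topology \<Rightarrow> ('a \<Rightarrow> 'b) \<Rightarrow> ('b, 'r::ab_group_add) cochain \<Rightarrow> ('a, 'r) cochain" where
  "cochain_pullback n X f c = (\<lambda>\<sigma>. if singular_simplex n X \<sigma> then c (simplex_map n f \<sigma>) else 0)"

text \<open>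
  Here and below a homomorphism of quotient groups is written as the union of the cosets of the images
  of all representatives; these cosets coincide.
\<close>

definition induced_hom ::
    "'a topology \<Rightarrow> ('a \<Rightarrow> 'b) \<Rightarrow> ('b, 'r::ab_group_add) total_class \<Rightarrow> ('a, 'r) total_class" where
  "induced_hom X f l = (\<lambda>n. \<Union>c\<in>l n. cochain_pullback n X f c +o coboundaries n X)"


section \<open>The Leray--Serre spectral sequence\<close>

text \<open>
  We use the construction of A. Dress (Zur Spektralsequenz von Faserungen, 1967).  For a map \<pi> from E
  to B, a singular (p,q)-simplex over \<pi> is a map from the product of a p-simplex and a q-simplex to
  E whose composition with \<pi> depends on the first variable only.  The functions on the singular
  (p,q)-simplices form a first quadrant double complex.  Filtering its total complex by p gives a
  spectral sequence that is natural in \<pi>; its first page is in bidegree (p,q) the product of the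
  q-th cohomology groups of the spaces of lifts of the singular p-simplices of B.  For a Serre
  fibration such a space of lifts is weakly equivalent to the fibre, so that the second page is the
  cohomology of B with local coefficients in the cohomology of the fibre, and the spectral sequence
  converges to the cohomology of E.
\<close>

type_synonym ('a, 'r) bicochain = "nat \<Rightarrow> nat \<Rightarrow> ((nat \<Rightarrow> real) \<times> (nat \<Rightarrow> real) \<Rightarrow> 'a) \<Rightarrow> 'r"

definition bisimplex ::
    "nat \<Rightarrow> nat \<Rightarrow> 'a topology \<Rightarrow> ('a \<Rightarrow> 'b) \<Rightarrow> ((nat \<Rightarrow> real) \<times> (nat \<Rightarrow> real) \<Rightarrow> 'a) \<Rightarrow> bool" where
  "bisimplex p q E \<pi> \<sigma> \<longleftrightarrow>
     continuous_map
       (prod_topology (subtopology (powertop_real UNIV) (standard_simplex p))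
                      (subtopology (powertop_real UNIV) (standard_simplex q))) E \<sigma> \<and>
     \<sigma> \<in> extensional (standard_simplex p \<times> standard_simplex q) \<and>
     (\<forall>s\<in>standard_simplex p. \<forall>t\<in>standard_simplex q. \<forall>t'\<in>standard_simplex q.
        \<pi> (\<sigma> (s, t)) = \<pi> (\<sigma> (s, t')))"

definition horizontal_face ::
    "nat \<Rightarrow> nat \<Rightarrow> nat \<Rightarrow> ((nat \<Rightarrow> real) \<times> (nat \<Rightarrow> real) \<Rightarrow> 'a) \<Rightarrow> (nat \<Rightarrow> real) \<times> (nat \<Rightarrow> real) \<Rightarrow> 'a" where
  "horizontal_face p q i \<sigma> =
     restrict (\<lambda>(s, t). \<sigma> (simplical_face i s, t)) (standard_simplex (p - 1) \<times> standard_simplex q)"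

definition vertical_face ::
    "nat \<Rightarrow> nat \<Rightarrow> nat \<Rightarrow> ((nat \<Rightarrow> real) \<times> (nat \<Rightarrow> real) \<Rightarrow> 'a) \<Rightarrow> (nat \<Rightarrow> real) \<times> (nat \<Rightarrow> real) \<Rightarrow> 'a" where
  "vertical_face p q j \<sigma> =
     restrict (\<lambda>(s, t). \<sigma> (s, simplical_face j t)) (standard_simplex p \<times> standard_simplex (q - 1))"

text \<open>The total complex, in integer degrees so that the group of degree -1 is zero.\<close>

definition total_cochains :: "'a topology \<Rightarrow> ('a \<Rightarrow> 'b) \<Rightarrow> int \<Rightarrow> ('a, 'r::ab_group_add) bicochain set" where
  "total_cochains E \<pi> n =
     {x. \<forall>p q \<sigma>. \<not> (int (p + q) = n \<and> bisimplex p q E \<pi> \<sigma>) \<longrightarrow> x p q \<sigma> = 0}"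

definition total_differential ::
    "'a topology \<Rightarrow> ('a \<Rightarrow> 'b) \<Rightarrow> ('a, 'r::ab_group_add) bicochain \<Rightarrow> ('a, 'r) bicochain" where
  "total_differential E \<pi> x =
     (\<lambda>p q \<sigma>. if bisimplex p q E \<pi> \<sigma>
        then (if p = 0 then 0 else \<Sum>i\<le>p. signed i (x (p - 1) q (horizontal_face p q i \<sigma>))) +
             signed p (if q = 0 then 0 else \<Sum>j\<le>q. signed j (x p (q - 1) (vertical_face p q j \<sigma>)))
        else 0)"

definition filtration :: "enat \<Rightarrow> ('a, 'r::ab_group_add) bicochain set" where
  "filtration s = {x. \<forall>p q \<sigma>. enat p < s \<longrightarrow> x p q \<sigma> = 0}"

text \<open>The elements of degree n and filtration s whose differential has filtration t.\<close>

definition almost_cocycles ::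
    "'a topology \<Rightarrow> ('a \<Rightarrow> 'b) \<Rightarrow> enat \<Rightarrow> enat \<Rightarrow> int \<Rightarrow> ('a, 'r::ab_group_add) bicochain set" where
  "almost_cocycles E \<pi> s t n =
     {x \<in> total_cochains E \<pi> n. x \<in> filtration s \<and> total_differential E \<pi> x \<in> filtration t}"

text \<open>
  With Z(r,p,n) the group of elements of degree n and filtration p whose differential has filtration
  p+r, and n = p+q, the entry E(r,p,q) is the usual quotient
  Z(r,p,n) / (d Z(r-1,p-r+1,n-1) + Z(r-1,p+1,n)).
  The difference \<^term>\<open>enat (p + 1) - r\<close> is truncated at 0, which is harmless because the filtration
  is constant in degrees \<open>\<le> 0\<close>.  For \<open>r = \<infinity>\<close> one gets the permanent cocycles modulo all boundaries
  and the permanent cocycles of filtration p+1.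
\<close>

definition page_boundaries ::
    "'a topology \<Rightarrow> ('a \<Rightarrow> 'b) \<Rightarrow> enat \<Rightarrow> nat \<Rightarrow> nat \<Rightarrow> ('a, 'r::ab_group_add) bicochain set" where
  "page_boundaries E \<pi> r p q =
     total_differential E \<pi> ` almost_cocycles E \<pi> (enat (p + 1) - r) (enat p) (int (p + q) - 1) +
     almost_cocycles E \<pi> (enat (p + 1)) (enat p + r) (int (p + q))"

definition page ::
    "'a topology \<Rightarrow> ('a \<Rightarrow> 'b) \<Rightarrow> enat \<Rightarrow> nat \<Rightarrow> nat \<Rightarrow> ('a, 'r::ab_group_add) bicochain set set" where
  "page E \<pi> r p q =
     (\<lambda>x. x +o page_boundaries E \<pi> r p q) ` almost_cocycles E \<pi> (enat p) (enat p + r) (int (p + q))"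

text \<open>
  A singular (n,0)-simplex over \<pi> is a singular n-simplex of E, and a cochain of B is evaluated on its
  projection to B.  When the fibres are path connected this gives the canonical isomorphism of the
  cohomology of B with the bottom row of the second page.
\<close>

definition bottom_cochain ::
    "'a topology \<Rightarrow> ('a \<Rightarrow> 'b) \<Rightarrow> nat \<Rightarrow> ('b, 'r::ab_group_add) cochain \<Rightarrow> ('a, 'r) bicochain" where
  "bottom_cochain E \<pi> n c =
     (\<lambda>p q \<sigma>. if p = n \<and> q = 0 \<and> bisimplex p q E \<pi> \<sigma>
        then c (restrict (\<lambda>s. \<pi> (\<sigma> (s, \<lambda>i. if i = 0 then 1 else 0))) (standard_simplex n))
        else 0)"

definition base_to_second_page ::
    "'a topology \<Rightarrow> ('a \<Rightarrow> 'b) \<Rightarrow> nat \<Rightarrow> ('b, 'r::ab_group_add) cochain set \<Rightarrow> ('a, 'r) bicochain set" where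
  "base_to_second_page E \<pi> n h = (\<Union>c\<in>h. bottom_cochain E \<pi> n c +o page_boundaries E \<pi> 2 n 0)"

text \<open>The canonical quotient map, in the bottom row, from page r to page s, where \<open>2 \<le> r \<le> s\<close>.\<close>

definition bottom_row_quotient ::
    "'a topology \<Rightarrow> ('a \<Rightarrow> 'b) \<Rightarrow> enat \<Rightarrow> enat \<Rightarrow> nat \<Rightarrow>
     ('a, 'r::ab_group_add) bicochain set \<Rightarrow> ('a, 'r) bicochain set" where
  "bottom_row_quotient E \<pi> r s n = (\<lambda>e\<in>page E \<pi> r n 0. \<Union>x\<in>e. x +o page_boundaries E \<pi> s n 0)"

definition edge_hom ::
    "'a topology \<Rightarrow> ('a \<Rightarrow> 'b) \<Rightarrow> enat \<Rightarrow> nat \<Rightarrow>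
     ('b, 'r::ab_group_add) cochain set \<Rightarrow> ('a, 'r) bicochain set" where
  "edge_hom E \<pi> r n h = bottom_row_quotient E \<pi> 2 r n (base_to_second_page E \<pi> n h)"


section \<open>Partial Borel indices\<close>

text \<open>The zero element of the entry (n,0) of page r is the coset \<open>page_boundaries\<close>.\<close>

definition partial_borel_index ::
    "enat \<Rightarrow> 'g monoid \<Rightarrow> 'e topology \<Rightarrow> ('g \<Rightarrow> 'e \<Rightarrow> 'e) \<Rightarrow> 'z topology \<Rightarrow> ('g \<Rightarrow> 'z \<Rightarrow> 'z) \<Rightarrow>
     ('e set, 'r::ab_group_add) total_class set" where
  "partial_borel_index r K E a Z b =
     {l \<in> total_cohomology (orbit_space K E a).
        \<forall>n. edge_hom (borel_construction K E a Z b) borel_projection r n (l n) =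
            page_boundaries (borel_construction K E a Z b) borel_projection r n 0}"

text \<open>
  The map \<epsilon> from EG to EH is a \<phi>-equivariant map, and the homomorphism induced by \<phi> on the
  cohomology of classifying spaces is the one induced by \<^term>\<open>classifying_map H b \<epsilon>\<close>.
\<close>

definition index_obstructions ::
    "enat \<Rightarrow> 'g monoid \<Rightarrow> 'e topology \<Rightarrow> ('g \<Rightarrow> 'e \<Rightarrow> 'e) \<Rightarrow> 'x topology \<Rightarrow> ('g \<Rightarrow> 'x \<Rightarrow> 'x) \<Rightarrow>
     'h monoid \<Rightarrow> 'f topology \<Rightarrow> ('h \<Rightarrow> 'f \<Rightarrow> 'f) \<Rightarrow> 'y topology \<Rightarrow> ('h \<Rightarrow> 'y \<Rightarrow> 'y) \<Rightarrow> ('e \<Rightarrow> 'f) \<Rightarrow>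
     ('f set, 'r::ab_group_add) total_class set" where
  "index_obstructions r G EG aEG X aX H EH aEH Y aY \<epsilon> =
     {l \<in> partial_borel_index r H EH aEH Y aY.
        induced_hom (orbit_space G EG aEG) (classifying_map H aEH \<epsilon>) l
          \<notin> partial_borel_index r G EG aEG X aX}"

end

theory Submission
  imports Defs
begin

text \<open>
  A \<phi>-equivariant map f induces a map F of Borel constructions lying over the map of classifying
  spaces.  Composition with F pulls bicochains back, commutes with the total differential and
  respects the filtration, and it carries the bottom row cochain of c to that of the pullback
  of c.  In the bottom row the zero element of each page consists of differentials only, so
  F maps partial indices into partial indices, and no index obstruction can exist.
\<close>

section \<open>Cosets in additive groups\<close>

text \<open>In total degree \<open>n\<close> the entry \<open>(n, 0)\<close> is the deepest step of
  the filtration: cochains of degree \<open>n\<close> live in columns \<open>p \<le> n\<close>, so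
  the summand of filtration \<open>n + 1\<close> in \<open>page_boundaries\<close> is zero. A class
  of the base thus dies on page \<open>r\<close> iff its bottom cochain is the total differential of
  a cochain of degree \<open>n - 1\<close> and filtration \<open>n + 1 - r\<close>, truncated at 0.
  Pulling back one such primitive handles all \<open>r\<close>, including
  \<open>\<infinity>\<close>, without induction over pages. The remaining work comes from the
  encoding of quotients: homomorphisms are unions of cosets over representatives, and each must be
  reduced to a single coset. The bound \<open>2 \<le> r\<close> enters there: the bottom cochain of
  a coboundary has a primitive of filtration \<open>n - 1\<close>, and
  \<open>n + 1 - r \<le> n - 1\<close> for \<open>2 \<le> r\<close>.\<close>

definition add_subgroup :: "'a::ab_group_add set \<Rightarrow> bool" where
  "add_subgroup S \<longleftrightarrow> 0 \<in> S \<and> (\<forall>x\<in>S. \<forall>y\<in>S. x - y \<in> S)"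

lemma add_subgroup_zero: "add_subgroup S \<Longrightarrow> 0 \<in> S"
  by (simp add: add_subgroup_def)

lemma add_subgroup_diff: "add_subgroup S \<Longrightarrow> x \<in> S \<Longrightarrow> y \<in> S \<Longrightarrow> x - y \<in> S"
  by (simp add: add_subgroup_def)

lemma add_subgroup_add: "add_subgroup S \<Longrightarrow> x \<in> S \<Longrightarrow> y \<in> S \<Longrightarrow> x + y \<in> S"
  using add_subgroup_diff[of S x "0 - y"] add_subgroup_diff[of S 0 y] add_subgroup_zero[of S]
  by simp

lemma coset_absorb:
  assumes "add_subgroup S" and "s \<in> S"
  shows "(x + s) +o S = x +o S"
proof -
  have "x + s + t \<in> x +o S" if "t \<in> S" for t
    using add_subgroup_add[OF assms that] by (auto simp: elt_set_plus_def add.assoc)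
  moreover have "x + t \<in> (x + s) +o S" if "t \<in> S" for t
    using add_subgroup_diff[OF assms(1) that assms(2)]
    by (auto simp: elt_set_plus_def intro!: bexI[of _ "t - s"])
  ultimately show ?thesis
    by (auto simp: elt_set_plus_def)
qed

lemma coset_eq_subgroup_iff:
  assumes "add_subgroup S"
  shows "x +o S = S \<longleftrightarrow> x \<in> S"
proof
  assume "x +o S = S"
  then show "x \<in> S"
    using add_subgroup_zero[OF assms] by (force simp: elt_set_plus_def)
next
  assume "x \<in> S"
  then show "x +o S = S"
    using coset_absorb[OF assms, of x 0] by simp
qed

text \<open>Well-definedness of a homomorphism of quotients: \<open>induced_hom\<close>,
  \<open>base_to_second_page\<close> and \<open>bottom_row_quotient\<close> are all unions of this
  shape. Representatives differ by elements of \<open>S\<close>, and \<open>f\<close> sends these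
  into \<open>T\<close>.\<close>

lemma UN_coset_image:
  fixes x :: "'a::ab_group_add" and f :: "'a \<Rightarrow> 'b::ab_group_add"
  assumes "0 \<in> S" and "add_subgroup T"
    and "\<And>s. s \<in> S \<Longrightarrow> f (x + s) = f x + f s" and "\<And>s. s \<in> S \<Longrightarrow> f s \<in> T"
  shows "(\<Union>y\<in>x +o S. f y +o T) = f x +o T"
proof -
  have "f y +o T = f x +o T" if y: "y \<in> x +o S" for y
  proof -
    obtain s where "s \<in> S" "y = x + s"
      using y by (auto simp: elt_set_plus_def)
    then show ?thesis
      using assms(3,4) coset_absorb[OF assms(2)] by simp
  qed
  moreover have "x \<in> x +o S"
    using set_plus_intro2[OF assms(1), of x] by simp
  ultimately show ?thesis
    by blast
qed

lemma add_subgroup_image: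
  assumes "add_subgroup S" and "\<And>x y. f (x - y) = f x - f y"
  shows "add_subgroup (f ` S)"
proof -
  have "f 0 = 0"
    using assms(2)[of 0 0] by simp
  then show ?thesis
    unfolding add_subgroup_def
    using add_subgroup_zero[OF assms(1)] add_subgroup_diff[OF assms(1)]
    by (force simp: assms(2)[symmetric])
qed

lemma signed_zero [simp]: "signed i 0 = 0"
  by (simp add: signed_def)

lemma signed_0 [simp]: "signed 0 x = x"
  by (simp add: signed_def)

lemma signed_Suc [simp]: "signed (Suc i) x = - signed i x"
  by (simp add: signed_def)

lemma signed_diff: "signed i (x - y) = signed i x - signed i y"
  by (simp add: signed_def)


section \<open>Functoriality of singular cohomology\<close>

lemma coboundary_diff: "coboundary n X (c - d) = coboundary n X c - coboundary n X d"
  by (auto simp: coboundary_def fun_eq_iff signed_diff sum_subtractf)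

lemma add_subgroup_cochains: "add_subgroup (cochains n X)"
  by (simp add: add_subgroup_def cochains_def)

lemma add_subgroup_coboundaries: "add_subgroup (coboundaries n X)"
proof (cases n)
  case 0
  then show ?thesis
    by (simp add: coboundaries_def add_subgroup_def)
next
  case (Suc m)
  then show ?thesis
    by (auto simp: coboundaries_def
        intro: add_subgroup_image add_subgroup_cochains coboundary_diff)
qed

lemma cochain_pullback_in_cochains: "cochain_pullback n X f c \<in> cochains n X"
  by (simp add: cochain_pullback_def cochains_def)

lemma cochain_pullback_zero [simp]: "cochain_pullback n X f 0 = 0"
  by (simp add: cochain_pullback_def fun_eq_iff)

lemma cochain_pullback_add:
  "cochain_pullback n X f (c + d) = cochain_pullback n X f c + cochain_pullback n X f d"
  by (auto simp: cochain_pullback_def fun_eq_iff)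

text \<open>Faces precompose and \<open>simplex_map\<close> postcomposes, so the two commute; faces
  and images of singular simplices are singular, so all guards hold.\<close>

lemma coboundary_cochain_pullback:
  assumes "continuous_map X Y f"
  shows "coboundary n X (cochain_pullback n X f c) =
    cochain_pullback (Suc n) X f (coboundary n Y c)"
proof
  fix \<sigma>
  show "coboundary n X (cochain_pullback n X f c) \<sigma> =
    cochain_pullback (Suc n) X f (coboundary n Y c) \<sigma>"
  proof (cases "singular_simplex (Suc n) X \<sigma>")
    case True
    have "singular_simplex n X (singular_face (Suc n) i \<sigma>)" if "i \<le> Suc n" for i
      using singular_simplex_singular_face[OF True, of i] that by simp
    moreover have "singular_face (Suc n) i (simplex_map (Suc n) f \<sigma>) =
        simplex_map n f (singular_face (Suc n) i \<sigma>)" if "i \<le> Suc n" for i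
      using singular_face_simplex_map[of "Suc n" i f \<sigma>] that
      by (auto simp: simplex_map_def singular_face_def fun_eq_iff)
    moreover have "singular_simplex (Suc n) Y (simplex_map (Suc n) f \<sigma>)"
      by (rule singular_simplex_simplex_map[OF True assms])
    ultimately show ?thesis
      using True by (simp add: coboundary_def cochain_pullback_def)
  next
    case False
    then show ?thesis
      by (simp add: coboundary_def cochain_pullback_def)
  qed
qed

lemma cochain_pullback_cocycles:
  assumes "continuous_map X Y f" and "c \<in> cocycles n Y"
  shows "cochain_pullback n X f c \<in> cocycles n X"
  using assms(2)
  by (simp add: cocycles_def cochain_pullback_in_cochains coboundary_cochain_pullback[OF assms(1)])

lemma cochain_pullback_coboundaries:
  assumes "continuous_map X Y f" and "c \<in> coboundaries n Y"
  shows "cochain_pullback n X f c \<in> coboundaries n X"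
proof (cases n)
  case 0
  then show ?thesis
    using assms(2) by (simp add: coboundaries_def)
next
  case (Suc m)
  then obtain d where "c = coboundary m Y d"
    using assms(2) by (auto simp: coboundaries_def)
  then have "cochain_pullback n X f c = coboundary m X (cochain_pullback m X f d)"
    by (simp add: coboundary_cochain_pullback[OF assms(1)] Suc)
  then show ?thesis
    using Suc by (auto simp: coboundaries_def cochain_pullback_in_cochains)
qed

lemma induced_hom_coset:
  assumes "continuous_map X Y f" and "l n = c +o coboundaries n Y"
  shows "induced_hom X f l n = cochain_pullback n X f c +o coboundaries n X"
  unfolding induced_hom_def assms(2)
  by (intro UN_coset_image add_subgroup_zero add_subgroup_coboundaries cochain_pullback_add
      cochain_pullback_coboundaries[OF assms(1)])

lemma induced_hom_total_cohomology:
  assumes f: "continuous_map X Y f" and l: "l \<in> total_cohomology Y"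
  shows "induced_hom X f l \<in> total_cohomology X"
proof -
  have "induced_hom X f l n \<in> cohomology n X" for n
  proof -
    obtain c where "c \<in> cocycles n Y" "l n = c +o coboundaries n Y"
      using l by (auto simp: total_cohomology_def cohomology_def)
    then show ?thesis
      using cochain_pullback_cocycles[OF f]
      by (auto simp: cohomology_def induced_hom_coset[OF f])
  qed
  \<comment> \<open>The zero class is the coset of the cochain 0; its preservation keeps the support
    finite.\<close>
  moreover have "induced_hom X f l n = coboundaries n X" if "l n = coboundaries n Y" for n
    using induced_hom_coset[OF f, of l n 0] that by simp
  then have "{n. induced_hom X f l n \<noteq> coboundaries n X} \<subseteq> {n. l n \<noteq> coboundaries n Y}"
    by blast
  ultimately show ?thesis
    using l by (auto simp: total_cohomology_def intro: finite_subset)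
qed


section \<open>The edge homomorphism\<close>

lemma total_differential_diff:
  "total_differential E \<pi> (x - y) = total_differential E \<pi> x - total_differential E \<pi> y"
  by (auto simp: total_differential_def fun_eq_iff signed_diff sum_subtractf algebra_simps)

lemma total_differential_zero [simp]: "total_differential E \<pi> 0 = 0"
  using total_differential_diff[of E \<pi> 0 0] by simp

lemma add_subgroup_almost_cocycles: "add_subgroup (almost_cocycles E \<pi> s t n)"
  by (simp add: add_subgroup_def almost_cocycles_def total_cochains_def filtration_def
      total_differential_diff)

text \<open>The double complex lies in the first quadrant: \<open>p + q = n\<close> forces
  \<open>p \<le> n\<close>, while filtration \<open>n + 1\<close> kills exactly these
  columns.\<close>

lemma almost_cocycles_above_degree:
  fixes E :: "'a topology"
  shows "almost_cocycles E \<pi> (enat (n + 1)) t (int n) = ({0} :: ('a, 'r::ab_group_add) bicochain set)"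
proof -
  have "x = 0" if x: "x \<in> almost_cocycles E \<pi> (enat (n + 1)) t (int n)"
    for x :: "('a, 'r) bicochain"
  proof (intro ext)
    fix p q \<sigma>
    show "x p q \<sigma> = (0 :: ('a, 'r) bicochain) p q \<sigma>"
      using x by (cases "p < n + 1") (auto simp: almost_cocycles_def total_cochains_def filtration_def)
  qed
  then show ?thesis
    using add_subgroup_zero[OF add_subgroup_almost_cocycles] by blast
qed

lemma page_boundaries_bottom_row:
  "page_boundaries E \<pi> r n 0 =
     total_differential E \<pi> ` almost_cocycles E \<pi> (enat (n + 1) - r) (enat n) (int n - 1)"
  by (simp add: page_boundaries_def set_plus_def image_def
      almost_cocycles_above_degree[unfolded Suc_eq_plus1[symmetric]])

lemma add_subgroup_page_boundaries_bottom_row: "add_subgroup (page_boundaries E \<pi> r n 0)"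
  unfolding page_boundaries_bottom_row
  by (intro add_subgroup_image add_subgroup_almost_cocycles total_differential_diff)

text \<open>A larger \<open>r\<close> admits primitives of lower filtration. This inclusion makes
  the quotient maps between pages well defined.\<close>

lemma page_boundaries_bottom_row_mono:
  assumes "r \<le> s"
  shows "page_boundaries E \<pi> r n 0 \<subseteq> page_boundaries E \<pi> s n 0"
proof -
  have "enat (n + 1) - s \<le> enat (n + 1) - r"
    using assms by (cases r; cases s) auto
  then have "filtration (enat (n + 1) - r) \<subseteq> filtration (enat (n + 1) - s)"
    unfolding filtration_def using order.strict_trans2 by blast
  then show ?thesis
    unfolding page_boundaries_bottom_row almost_cocycles_def by blast
qed

lemma bottom_cochain_add:
  "bottom_cochain E \<pi> n (c + d) = bottom_cochain E \<pi> n c + bottom_cochain E \<pi> n d"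
  by (auto simp: bottom_cochain_def fun_eq_iff)

lemma bottom_cochain_zero [simp]: "bottom_cochain E \<pi> n 0 = 0"
  by (simp add: bottom_cochain_def fun_eq_iff)

section \<open>Simplices over \<open>\<pi>\<close>, their faces and their projections to the
  base\<close>

lemma vertex_in_standard_simplex: "(\<lambda>i. if i = 0 then 1 else 0) \<in> standard_simplex q"
  using basis_in_standard_simplex[of 0 q] by (simp add: eq_commute)

lemma bisimplex_in_topspace:
  assumes "bisimplex p q E \<pi> \<sigma>" and "s \<in> standard_simplex p" and "t \<in> standard_simplex q"
  shows "\<sigma> (s, t) \<in> topspace E"
  using assms continuous_map_image_subset_topspace unfolding bisimplex_def by fastforce

text \<open>The face map is the \<open>i\<close>-th singular face of the identity simplex of the
  standard simplex, and faces of singular simplices are continuous.\<close>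

lemma continuous_map_simplical_face:
  assumes "1 \<le> p" and "i \<le> p"
  shows "continuous_map (subtopology (powertop_real UNIV) (standard_simplex (p - 1)))
    (subtopology (powertop_real UNIV) (standard_simplex p)) (simplical_face i)"
proof -
  have "continuous_map (subtopology (powertop_real UNIV) (standard_simplex p))
      (subtopology (powertop_real UNIV) (standard_simplex p)) (restrict id (standard_simplex p))"
    by (rule continuous_map_eq[OF continuous_map_id]) simp
  then have "singular_simplex p (subtopology (powertop_real UNIV) (standard_simplex p))
      (restrict id (standard_simplex p))"
    by (simp add: singular_simplex_def)
  from singular_simplex_singular_face[OF this assms]
  have "continuous_map (subtopology (powertop_real UNIV) (standard_simplex (p - 1)))
      (subtopology (powertop_real UNIV) (standard_simplex p))
      (singular_face p i (restrict id (standard_simplex p)))"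
    by (simp add: singular_simplex_def)
  then show ?thesis
    by (rule continuous_map_eq)
      (use assms simplical_face_in_standard_simplex in \<open>auto simp: singular_face_def\<close>)
qed

text \<open>Changing the two variables separately keeps the projection independent of the second
  one. Horizontal and vertical faces are the cases in which one change is the identity.\<close>

lemma bisimplex_reparametrize:
  assumes \<sigma>: "bisimplex p q E \<pi> \<sigma>"
    and f: "continuous_map (subtopology (powertop_real UNIV) (standard_simplex p'))
      (subtopology (powertop_real UNIV) (standard_simplex p)) f"
    and g: "continuous_map (subtopology (powertop_real UNIV) (standard_simplex q'))
      (subtopology (powertop_real UNIV) (standard_simplex q)) g"
  shows "bisimplex p' q' E \<pi>
    (restrict (\<lambda>(s, t). \<sigma> (f s, g t)) (standard_simplex p' \<times> standard_simplex q'))"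
    (is "bisimplex _ _ _ _ (restrict ?\<tau> _)")
proof -
  let ?\<Delta> = "\<lambda>p. subtopology (powertop_real UNIV) (standard_simplex p)"
  have "continuous_map (prod_topology (?\<Delta> p') (?\<Delta> q')) (prod_topology (?\<Delta> p) (?\<Delta> q))
      (\<lambda>(s, t). (f s, g t))"
    using f g by (simp add: continuous_map_prod_top)
  moreover have "continuous_map (prod_topology (?\<Delta> p) (?\<Delta> q)) E \<sigma>"
    using \<sigma> by (simp add: bisimplex_def)
  ultimately have "continuous_map (prod_topology (?\<Delta> p') (?\<Delta> q')) E
      (\<sigma> \<circ> (\<lambda>(s, t). (f s, g t)))"
    by (rule continuous_map_compose)
  then have "continuous_map (prod_topology (?\<Delta> p') (?\<Delta> q')) E
      (restrict ?\<tau> (standard_simplex p' \<times> standard_simplex q'))"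
    by (rule continuous_map_eq) auto
  moreover have "f s \<in> standard_simplex p" if "s \<in> standard_simplex p'" for s
    using continuous_map_funspace[OF f] that by auto
  moreover have "g t \<in> standard_simplex q" if "t \<in> standard_simplex q'" for t
    using continuous_map_funspace[OF g] that by auto
  ultimately show ?thesis
    using \<sigma> by (simp add: bisimplex_def)
qed

lemma bisimplex_horizontal_face:
  assumes "bisimplex p q E \<pi> \<sigma>" and "1 \<le> p" and "i \<le> p"
  shows "bisimplex (p - 1) q E \<pi> (horizontal_face p q i \<sigma>)"
  using bisimplex_reparametrize[OF assms(1) continuous_map_simplical_face[OF assms(2,3)]
      continuous_map_id]
  by (simp add: horizontal_face_def)

lemma bisimplex_vertical_face:
  assumes "bisimplex p q E \<pi> \<sigma>" and "1 \<le> q" and "j \<le> q"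
  shows "bisimplex p (q - 1) E \<pi> (vertical_face p q j \<sigma>)"
  using bisimplex_reparametrize[OF assms(1) continuous_map_id
      continuous_map_simplical_face[OF assms(2,3)]]
  by (simp add: vertical_face_def)

text \<open>The projection of \<open>\<sigma>\<close> to the base; for a bisimplex the choice of
  vertex is immaterial. As an abbreviation it matches the unfolded
  \<open>bottom_cochain_def\<close>.\<close>

abbreviation bottom_simplex ::
    "nat \<Rightarrow> ('a \<Rightarrow> 'b) \<Rightarrow> ((nat \<Rightarrow> real) \<times> (nat \<Rightarrow> real) \<Rightarrow> 'a) \<Rightarrow> (nat \<Rightarrow> real) \<Rightarrow> 'b" where
  "bottom_simplex n \<pi> \<sigma> \<equiv>
     restrict (\<lambda>s. \<pi> (\<sigma> (s, \<lambda>i. if i = 0 then 1 else 0))) (standard_simplex n)"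

lemma singular_simplex_bottom_simplex:
  assumes "continuous_map E B \<pi>" and "bisimplex n q E \<pi> \<sigma>"
  shows "singular_simplex n B (bottom_simplex n \<pi> \<sigma>)"
proof -
  let ?\<Delta> = "\<lambda>p. subtopology (powertop_real UNIV) (standard_simplex p)"
    and ?v = "\<lambda>i::nat. if i = 0 then 1 else 0 :: real"
  have "continuous_map (?\<Delta> n) (prod_topology (?\<Delta> n) (?\<Delta> q)) (\<lambda>s. (s, ?v))"
    using vertex_in_standard_simplex by (intro continuous_map_pairedI) auto
  moreover have "continuous_map (prod_topology (?\<Delta> n) (?\<Delta> q)) B (\<pi> \<circ> \<sigma>)"
    using assms continuous_map_compose by (auto simp: bisimplex_def)
  ultimately have "continuous_map (?\<Delta> n) B (\<pi> \<circ> \<sigma> \<circ> (\<lambda>s. (s, ?v)))"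
    by (rule continuous_map_compose)
  then have "continuous_map (?\<Delta> n) B (bottom_simplex n \<pi> \<sigma>)"
    by (rule continuous_map_eq) simp
  then show ?thesis
    by (simp add: singular_simplex_def)
qed

lemma bottom_simplex_horizontal_face:
  assumes "i \<le> Suc n"
  shows "bottom_simplex n \<pi> (horizontal_face (Suc n) q i \<sigma>) =
    singular_face (Suc n) i (bottom_simplex (Suc n) \<pi> \<sigma>)"
  using assms simplical_face_in_standard_simplex[of "Suc n" i] vertex_in_standard_simplex
  by (auto simp: horizontal_face_def singular_face_def fun_eq_iff)

lemma bottom_simplex_vertical_face:
  assumes "bisimplex n 1 E \<pi> \<sigma>" and "j \<le> 1"
  shows "bottom_simplex n \<pi> (vertical_face n 1 j \<sigma>) = bottom_simplex n \<pi> \<sigma>"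
  using assms simplical_face_in_standard_simplex[of 1 j] vertex_in_standard_simplex
  by (auto simp: vertical_face_def bisimplex_def fun_eq_iff)

text \<open>The horizontal part in bidegree \<open>(n + 1, 0)\<close> is the coboundary of the base.
  The vertical part in bidegree \<open>(n, 1)\<close> cancels: both vertical faces have the same
  projection and enter with opposite signs.\<close>

lemma total_differential_bottom_cochain:
  assumes "continuous_map E B \<pi>"
  shows "total_differential E \<pi> (bottom_cochain E \<pi> n c) = bottom_cochain E \<pi> (Suc n) (coboundary n B c)"
proof (intro ext)
  fix p q \<sigma>
  show "total_differential E \<pi> (bottom_cochain E \<pi> n c) p q \<sigma> =
    bottom_cochain E \<pi> (Suc n) (coboundary n B c) p q \<sigma>"
  proof (cases "bisimplex p q E \<pi> \<sigma>")
    case False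
    then show ?thesis
      by (simp add: total_differential_def bottom_cochain_def)
  next
    case \<sigma>: True
    consider (base) "p = Suc n" "q = 0" | (fibre) "p = n" "q = 1"
      | (other) "\<not> (p = Suc n \<and> q = 0)" "\<not> (p = n \<and> q = 1)"
      by blast
    then show ?thesis
    proof cases
      case base
      have \<sigma>': "bisimplex (Suc n) 0 E \<pi> \<sigma>"
        using \<sigma> base by simp
      have "bisimplex n 0 E \<pi> (horizontal_face (Suc n) 0 i \<sigma>)" if "i \<le> Suc n" for i
        using bisimplex_horizontal_face[OF \<sigma>' _ that] by simp
      then show ?thesis
        unfolding base using \<sigma>' singular_simplex_bottom_simplex[OF assms \<sigma>']
        by (simp add: total_differential_def bottom_cochain_def coboundary_def
            bottom_simplex_horizontal_face del: restrict_apply)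
    next
      case fibre
      have \<sigma>': "bisimplex n 1 E \<pi> \<sigma>"
        using \<sigma> fibre by simp
      have "bottom_cochain E \<pi> n c n 0 (vertical_face n 1 j \<sigma>) = c (bottom_simplex n \<pi> \<sigma>)"
        if "j \<le> 1" for j
        using bisimplex_vertical_face[OF \<sigma>' _ that]
        by (simp add: bottom_cochain_def bottom_simplex_vertical_face[OF \<sigma>' that, simplified])
      moreover have "bottom_cochain E \<pi> n c (n - 1) 1 \<tau> = 0"
        "bottom_cochain E \<pi> (Suc n) (coboundary n B c) n 1 \<tau> = 0" for \<tau>
        by (simp_all add: bottom_cochain_def)
      ultimately show ?thesis
        unfolding fibre using \<sigma>' by (simp add: total_differential_def)
    next
      case other
      \<comment> \<open>The guards matter because subtraction truncates: with \<open>p = 0\<close>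
        or \<open>q = 0\<close> the predecessor would be 0 again and could hit the nonzero entry
        \<open>(n, 0)\<close>.\<close>
      have "bottom_cochain E \<pi> n c (p - 1) q \<tau> = 0" if "p \<noteq> 0" for \<tau>
        using other that by (auto simp: bottom_cochain_def)
      moreover have "bottom_cochain E \<pi> n c p (q - 1) \<tau> = 0" if "q \<noteq> 0" for \<tau>
        using other that by (auto simp: bottom_cochain_def)
      moreover have "bottom_cochain E \<pi> (Suc n) (coboundary n B c) p q \<sigma> = 0"
        using other by (auto simp: bottom_cochain_def)
      ultimately show ?thesis
        using \<sigma> by (cases "p = 0") (simp_all add: total_differential_def)
    qed
  qed
qed

section \<open>Bottom cochains on the pages, and the criterion for vanishing there\<close>

lemma bottom_cochain_in_almost_cocycles:
  assumes "s \<le> enat n" and "total_differential E \<pi> (bottom_cochain E \<pi> n c) \<in> filtration t"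
  shows "bottom_cochain E \<pi> n c \<in> almost_cocycles E \<pi> s t (int n)"
  using assms by (auto simp: almost_cocycles_def total_cochains_def filtration_def bottom_cochain_def)

lemma bottom_cochain_coboundaries:
  assumes \<pi>: "continuous_map E B \<pi>" and r: "2 \<le> r" and c: "c \<in> coboundaries n B"
  shows "bottom_cochain E \<pi> n c \<in> page_boundaries E \<pi> r n 0"
proof (cases n)
  case 0
  then show ?thesis
    using c add_subgroup_zero[OF add_subgroup_page_boundaries_bottom_row]
    by (simp add: coboundaries_def)
next
  case (Suc m)
  then obtain d where c_eq: "c = coboundary m B d"
    using c by (auto simp: coboundaries_def)
  \<comment> \<open>The primitive is the bottom cochain of \<open>d\<close>, of filtration
    \<open>m = n - 1\<close>; at \<open>r = 2\<close> this bound is an equality.\<close>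
  have "enat (n + 1) - r \<le> enat m"
    using Suc r by (cases r) (auto simp: numeral_eq_enat)
  moreover have "bottom_cochain E \<pi> (Suc m) (coboundary m B d) \<in> filtration (enat (Suc m))"
    by (auto simp: filtration_def bottom_cochain_def)
  ultimately have "bottom_cochain E \<pi> m d \<in> almost_cocycles E \<pi> (enat (n + 1) - r) (enat n) (int n - 1)"
    using bottom_cochain_in_almost_cocycles[of "enat (n + 1) - r" m E \<pi> d "enat n"] Suc
    by (simp add: total_differential_bottom_cochain[OF \<pi>])
  then show ?thesis
    unfolding page_boundaries_bottom_row c_eq
    using Suc by (auto simp: total_differential_bottom_cochain[OF \<pi>, symmetric])
qed

lemma edge_hom_coset:
  assumes \<pi>: "continuous_map E B \<pi>" and r: "2 \<le> r" and c: "c \<in> cocycles n B"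
  shows "edge_hom E \<pi> r n (c +o coboundaries n B) =
    bottom_cochain E \<pi> n c +o page_boundaries E \<pi> r n 0"
proof -
  have second_page: "base_to_second_page E \<pi> n (c +o coboundaries n B) =
      bottom_cochain E \<pi> n c +o page_boundaries E \<pi> 2 n 0"
    unfolding base_to_second_page_def
    by (intro UN_coset_image add_subgroup_zero add_subgroup_coboundaries bottom_cochain_add
        add_subgroup_page_boundaries_bottom_row bottom_cochain_coboundaries[OF \<pi>]) simp
  \<comment> \<open>\<open>bottom_row_quotient\<close> is \<open>undefined\<close> off page 2, so
    the coset must be shown to lie on that page; the cocycle condition gives a differential 0, which
    has every filtration.\<close>
  have "total_differential E \<pi> (bottom_cochain E \<pi> n c) = 0"
    using c by (simp add: total_differential_bottom_cochain[OF \<pi>] cocycles_def)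
  then have "bottom_cochain E \<pi> n c \<in> almost_cocycles E \<pi> (enat n) (enat n + 2) (int (n + 0))"
    using bottom_cochain_in_almost_cocycles[of "enat n" n E \<pi> c "enat n + 2"]
    by (simp add: filtration_def)
  then have "bottom_cochain E \<pi> n c +o page_boundaries E \<pi> 2 n 0 \<in> page E \<pi> 2 n 0"
    unfolding page_def by (rule imageI)
  moreover have "(\<Union>x\<in>bottom_cochain E \<pi> n c +o page_boundaries E \<pi> 2 n 0.
      x +o page_boundaries E \<pi> r n 0) = bottom_cochain E \<pi> n c +o page_boundaries E \<pi> r n 0"
    using page_boundaries_bottom_row_mono[OF r, of E \<pi> n]
    by (intro UN_coset_image[where f = "\<lambda>x. x"] add_subgroup_zero
        add_subgroup_page_boundaries_bottom_row) auto
  ultimately show ?thesis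
    by (simp add: edge_hom_def second_page bottom_row_quotient_def)
qed

lemma edge_hom_eq_zero_iff:
  assumes "continuous_map E B \<pi>" and "2 \<le> r" and "c \<in> cocycles n B"
  shows "edge_hom E \<pi> r n (c +o coboundaries n B) = page_boundaries E \<pi> r n 0 \<longleftrightarrow>
    bottom_cochain E \<pi> n c \<in> page_boundaries E \<pi> r n 0"
  by (simp add: edge_hom_coset[OF assms]
      coset_eq_subgroup_iff[OF add_subgroup_page_boundaries_bottom_row])


section \<open>Naturality of the spectral sequence\<close>

text \<open>The restriction keeps the composite \<open>extensional\<close>, as
  \<open>bisimplex\<close> demands.\<close>

definition bisimplex_map ::
    "nat \<Rightarrow> nat \<Rightarrow> ('a \<Rightarrow> 'b) \<Rightarrow> ((nat \<Rightarrow> real) \<times> (nat \<Rightarrow> real) \<Rightarrow> 'a) \<Rightarrow>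
     (nat \<Rightarrow> real) \<times> (nat \<Rightarrow> real) \<Rightarrow> 'b" where
  "bisimplex_map p q F \<sigma> = restrict (F \<circ> \<sigma>) (standard_simplex p \<times> standard_simplex q)"

definition bicochain_pullback ::
    "'a topology \<Rightarrow> ('a \<Rightarrow> 'c) \<Rightarrow> ('a \<Rightarrow> 'b) \<Rightarrow> ('b, 'r::ab_group_add) bicochain \<Rightarrow> ('a, 'r) bicochain" where
  "bicochain_pullback E \<pi> F x =
     (\<lambda>p q \<sigma>. if bisimplex p q E \<pi> \<sigma> then x p q (bisimplex_map p q F \<sigma>) else 0)"

text \<open>A commutative square from \<open>\<pi>\<close> to \<open>\<pi>'\<close>, the kind of
  morphism under which the construction is natural.\<close>

locale map_of_maps =
  fixes E :: "'a topology" and B :: "'b topology" and \<pi> :: "'a \<Rightarrow> 'b"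
    and E' :: "'c topology" and B' :: "'d topology" and \<pi>' :: "'c \<Rightarrow> 'd"
    and F :: "'a \<Rightarrow> 'c" and \<beta> :: "'b \<Rightarrow> 'd"
  assumes cont_\<pi>: "continuous_map E B \<pi>" and cont_\<pi>': "continuous_map E' B' \<pi>'"
    and cont_F: "continuous_map E E' F" and cont_\<beta>: "continuous_map B B' \<beta>"
    and commute: "x \<in> topspace E \<Longrightarrow> \<pi>' (F x) = \<beta> (\<pi> x)"
begin

lemma bisimplex_bisimplex_map:
  assumes "bisimplex p q E \<pi> \<sigma>"
  shows "bisimplex p q E' \<pi>' (bisimplex_map p q F \<sigma>)"
proof -
  let ?\<Delta> = "\<lambda>p. subtopology (powertop_real UNIV) (standard_simplex p)"
  have "continuous_map (prod_topology (?\<Delta> p) (?\<Delta> q)) E' (F \<circ> \<sigma>)"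
    using assms by (auto simp: bisimplex_def intro: continuous_map_compose[OF _ cont_F])
  then have "continuous_map (prod_topology (?\<Delta> p) (?\<Delta> q)) E' (bisimplex_map p q F \<sigma>)"
    by (rule continuous_map_eq) (auto simp: bisimplex_map_def)
  moreover have "\<pi>' (bisimplex_map p q F \<sigma> (s, t)) = \<pi>' (bisimplex_map p q F \<sigma> (s, t'))"
    if s: "s \<in> standard_simplex p" and t: "t \<in> standard_simplex q" and t': "t' \<in> standard_simplex q"
    for s t t'
  proof -
    have "\<pi> (\<sigma> (s, t)) = \<pi> (\<sigma> (s, t'))"
      using assms s t t' unfolding bisimplex_def by blast
    then show ?thesis
      using s t t' by (simp add: bisimplex_map_def commute bisimplex_in_topspace[OF assms])
  qed
  moreover have "bisimplex_map p q F \<sigma> \<in> extensional (standard_simplex p \<times> standard_simplex q)"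
    by (simp add: bisimplex_map_def)
  ultimately show ?thesis
    unfolding bisimplex_def by blast
qed

lemma total_differential_bicochain_pullback:
  "total_differential E \<pi> (bicochain_pullback E \<pi> F x) =
     bicochain_pullback E \<pi> F (total_differential E' \<pi>' x)"
proof (intro ext)
  fix p q \<sigma>
  show "total_differential E \<pi> (bicochain_pullback E \<pi> F x) p q \<sigma> =
     bicochain_pullback E \<pi> F (total_differential E' \<pi>' x) p q \<sigma>"
  proof (cases "bisimplex p q E \<pi> \<sigma>")
    case False
    then show ?thesis
      by (simp add: total_differential_def bicochain_pullback_def)
  next
    case True
    have "bisimplex_map (p - 1) q F (horizontal_face p q i \<sigma>) =
        horizontal_face p q i (bisimplex_map p q F \<sigma>)" if "1 \<le> p" "i \<le> p" for i
      using simplical_face_in_standard_simplex[OF that]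
      by (auto simp: bisimplex_map_def horizontal_face_def fun_eq_iff)
    then have h: "bicochain_pullback E \<pi> F x (p - 1) q (horizontal_face p q i \<sigma>) =
        x (p - 1) q (horizontal_face p q i (bisimplex_map p q F \<sigma>))" if "p \<noteq> 0" "i \<le> p" for i
      using that bisimplex_horizontal_face[OF True, of i] by (simp add: bicochain_pullback_def)
    have "bisimplex_map p (q - 1) F (vertical_face p q j \<sigma>) =
        vertical_face p q j (bisimplex_map p q F \<sigma>)" if "1 \<le> q" "j \<le> q" for j
      using simplical_face_in_standard_simplex[OF that]
      by (auto simp: bisimplex_map_def vertical_face_def fun_eq_iff)
    then have v: "bicochain_pullback E \<pi> F x p (q - 1) (vertical_face p q j \<sigma>) =
        x p (q - 1) (vertical_face p q j (bisimplex_map p q F \<sigma>))" if "q \<noteq> 0" "j \<le> q" for j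
      using that bisimplex_vertical_face[OF True, of j] by (simp add: bicochain_pullback_def)
    \<comment> \<open>\<open>if_cong\<close> hands the branch conditions \<open>p \<noteq> 0\<close>
      and \<open>q \<noteq> 0\<close> to the simplifier, as \<open>h\<close> and \<open>v\<close>
      require.\<close>
    have "total_differential E \<pi> (bicochain_pullback E \<pi> F x) p q \<sigma> =
        total_differential E' \<pi>' x p q (bisimplex_map p q F \<sigma>)"
      using True bisimplex_bisimplex_map[OF True] h v
      by (simp add: total_differential_def cong: if_cong)
    then show ?thesis
      using True by (simp add: bicochain_pullback_def)
  qed
qed

lemma bicochain_pullback_almost_cocycles:
  fixes x :: "('c, 'r::ab_group_add) bicochain"
  assumes "x \<in> almost_cocycles E' \<pi>' s t n"
  shows "bicochain_pullback E \<pi> F x \<in> almost_cocycles E \<pi> s t n"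
proof -
  have "bicochain_pullback E \<pi> F y \<in> filtration u" if "y \<in> filtration u"
    for u and y :: "('c, 'r) bicochain"
    using that by (simp add: filtration_def bicochain_pullback_def)
  moreover have "bicochain_pullback E \<pi> F x \<in> total_cochains E \<pi> n"
    using assms bisimplex_bisimplex_map
    by (auto simp: almost_cocycles_def total_cochains_def bicochain_pullback_def)
  ultimately show ?thesis
    using assms by (simp add: almost_cocycles_def total_differential_bicochain_pullback)
qed

lemma bicochain_pullback_page_boundaries:
  assumes "x \<in> page_boundaries E' \<pi>' r n 0"
  shows "bicochain_pullback E \<pi> F x \<in> page_boundaries E \<pi> r n 0"
  using assms
  by (auto simp: page_boundaries_bottom_row total_differential_bicochain_pullback[symmetric]
      intro: bicochain_pullback_almost_cocycles)

lemma bicochain_pullback_bottom_cochain: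
  "bicochain_pullback E \<pi> F (bottom_cochain E' \<pi>' n c) =
     bottom_cochain E \<pi> n (cochain_pullback n B \<beta> c)"
proof (intro ext)
  fix p q \<sigma>
  have "bottom_simplex n \<pi>' (bisimplex_map n 0 F \<sigma>) = simplex_map n \<beta> (bottom_simplex n \<pi> \<sigma>)"
    if "bisimplex n 0 E \<pi> \<sigma>"
    using commute bisimplex_in_topspace[OF that] vertex_in_standard_simplex
    by (auto simp: bisimplex_map_def simplex_map_def fun_eq_iff)
  then show "bicochain_pullback E \<pi> F (bottom_cochain E' \<pi>' n c) p q \<sigma> =
     bottom_cochain E \<pi> n (cochain_pullback n B \<beta> c) p q \<sigma>"
    using bisimplex_bisimplex_map[of n 0 \<sigma>] singular_simplex_bottom_simplex[OF cont_\<pi>, of n 0 \<sigma>]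
    by (auto simp: bicochain_pullback_def bottom_cochain_def cochain_pullback_def)
qed

text \<open>For a representing cocycle \<open>c\<close>, both equations become membership of a
  bottom cochain in \<open>page_boundaries\<close>; the pullback of \<open>c\<close> is again a
  cocycle, so the criterion applies on both sides.\<close>

lemma edge_hom_induced_hom_eq_zero:
  assumes r: "2 \<le> r" and l: "l n \<in> cohomology n B'"
    and zero: "edge_hom E' \<pi>' r n (l n) = page_boundaries E' \<pi>' r n 0"
  shows "edge_hom E \<pi> r n (induced_hom B \<beta> l n) = page_boundaries E \<pi> r n 0"
proof -
  obtain c where c: "c \<in> cocycles n B'" and l_eq: "l n = c +o coboundaries n B'"
    using l by (auto simp: cohomology_def)
  have "bottom_cochain E' \<pi>' n c \<in> page_boundaries E' \<pi>' r n 0"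
    using zero unfolding l_eq by (simp add: edge_hom_eq_zero_iff[OF cont_\<pi>' r c])
  then have "bottom_cochain E \<pi> n (cochain_pullback n B \<beta> c) \<in> page_boundaries E \<pi> r n 0"
    using bicochain_pullback_page_boundaries bicochain_pullback_bottom_cochain by metis
  then show ?thesis
    by (simp add: induced_hom_coset[OF cont_\<beta>, of l n c] l_eq
        edge_hom_eq_zero_iff[OF cont_\<pi> r cochain_pullback_cocycles[OF cont_\<beta> c]])
qed

end


section \<open>Maps of Borel constructions\<close>

text \<open>
  Invariance of orbits is assumed instead of a group action, because \<^const>\<open>group_action\<close> requires
  extensional maps and the diagonal action, written with \<^const>\<open>map_prod\<close>, is not extensional.
\<close>

lemma classifying_map_orbit:
  assumes "group G" and "\<phi> \<in> hom G H" and "equivariant_map G \<phi> X a Y b f"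
    and "\<And>h y. h \<in> carrier H \<Longrightarrow> y \<in> topspace Y \<Longrightarrow> orbit H b (b h y) = orbit H b y"
    and "x \<in> topspace X"
  shows "classifying_map H b f (orbit G a x) = orbit H b (f x)"
proof -
  have "f x \<in> topspace Y"
    using assms(3,5) continuous_map_image_subset_topspace unfolding equivariant_map_def by blast
  then have "orbit H b (f (a g x)) = orbit H b (f x)" if "g \<in> carrier G" for g
    using assms that hom_in_carrier[OF assms(2) that] by (simp add: equivariant_map_def)
  \<comment> \<open>A union of equal sets is their common value only over a nonempty index set, here
    the orbit.\<close>
  moreover have "carrier G \<noteq> {}"
    using group.is_monoid[OF assms(1)] monoid.one_closed by blast
  ultimately show ?thesis
    by (auto simp: classifying_map_def orbit_def[of G])
qed

lemma continuous_map_from_orbit_space: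
  assumes "\<And>x. x \<in> topspace X \<Longrightarrow> F (orbit G a x) = f x" and "continuous_map X Z f"
  shows "continuous_map (orbit_space G X a) Z F"
proof -
  have "continuous_map X Z (F \<circ> orbit G a)"
    by (rule continuous_map_eq[OF assms(2)]) (simp add: assms(1))
  then show ?thesis
    by (rule continuous_compose_quotient_map[OF quotient_map_orbit_space])
qed

lemma continuous_map_orbit: "continuous_map X (orbit_space G X a) (orbit G a)"
  by (rule quotient_imp_continuous_map[OF quotient_map_orbit_space])

lemma continuous_map_classifying_map:
  assumes "group G" and "\<phi> \<in> hom G H" and "equivariant_map G \<phi> X a Y b f"
    and "\<And>h y. h \<in> carrier H \<Longrightarrow> y \<in> topspace Y \<Longrightarrow> orbit H b (b h y) = orbit H b y"
  shows "continuous_map (orbit_space G X a) (orbit_space H Y b) (classifying_map H b f)"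
proof (rule continuous_map_from_orbit_space)
  have "continuous_map X Y f"
    using assms(3) by (simp add: equivariant_map_def)
  then show "continuous_map X (orbit_space H Y b) (\<lambda>x. orbit H b (f x))"
    using continuous_map_compose[OF _ continuous_map_orbit] by (force simp: o_def)
qed (rule classifying_map_orbit[OF assms])

text \<open>Right translation by \<open>g\<close> permutes the group. Only the composition law at
  this \<open>g\<close> and \<open>x\<close> is assumed, so the diagonal action is covered as
  well.\<close>

lemma orbit_translate:
  assumes "group G" and "g \<in> carrier G"
    and "\<And>k. k \<in> carrier G \<Longrightarrow> a (k \<otimes>\<^bsub>G\<^esub> g) x = a k (a g x)"
  shows "orbit G a (a g x) = orbit G a x"
proof -
  interpret group G by fact
  have "\<exists>k\<in>carrier G. a h x = a k (a g x)" if "h \<in> carrier G" for h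
    using assms(2) assms(3)[of "h \<otimes>\<^bsub>G\<^esub> inv\<^bsub>G\<^esub> g"] that by (intro bexI[of _ "h \<otimes>\<^bsub>G\<^esub> inv\<^bsub>G\<^esub> g"]) (simp_all add: m_assoc)
  moreover have "\<exists>h\<in>carrier G. a k (a g x) = a h x" if "k \<in> carrier G" for k
    using assms(2) assms(3)[OF that] that by (intro bexI[of _ "k \<otimes>\<^bsub>G\<^esub> g"]) simp_all
  ultimately show ?thesis
    unfolding orbit_def by blast
qed

lemma G_space_mult:
  assumes "G_space G T X a" and "g \<in> carrier G" and "h \<in> carrier G" and "x \<in> topspace X"
  shows "a (g \<otimes>\<^bsub>G\<^esub> h) x = a g (a h x)"
  using assms group_action.composition_rule unfolding G_space_def by metis

lemma orbit_diagonal_translate: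
  assumes "group G" and "G_space G T X a" and "G_space G T Y b"
    and "g \<in> carrier G" and "z \<in> topspace (prod_topology X Y)"
  shows "orbit G (\<lambda>g. map_prod (a g) (b g)) (map_prod (a g) (b g) z) =
    orbit G (\<lambda>g. map_prod (a g) (b g)) z"
proof (rule orbit_translate[where a = "\<lambda>g. map_prod (a g) (b g)"])
  fix k assume "k \<in> carrier G"
  then show "map_prod (a (k \<otimes>\<^bsub>G\<^esub> g)) (b (k \<otimes>\<^bsub>G\<^esub> g)) z =
      map_prod (a k) (b k) (map_prod (a g) (b g) z)"
    using assms(4,5) by (cases z) (simp add: G_space_mult[OF assms(2)] G_space_mult[OF assms(3)])
qed (use assms in auto)

lemma borel_projection_orbit:
  "borel_projection (orbit G (\<lambda>g. map_prod (a g) (b g)) z) = orbit G a (fst z)"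
  by (force simp: borel_projection_def orbit_def)

lemma continuous_map_borel_projection:
  "continuous_map (borel_construction G E a Z b) (orbit_space G E a) borel_projection"
  unfolding borel_construction_def
proof (rule continuous_map_from_orbit_space)
  show "continuous_map (prod_topology E Z) (orbit_space G E a) (\<lambda>z. orbit G a (fst z))"
    using continuous_map_compose[OF continuous_map_fst continuous_map_orbit] by (simp add: o_def)
qed (rule borel_projection_orbit)

text \<open>The map of Borel constructions is itself a \<open>classifying_map\<close>, for the
  diagonal action and \<open>map_prod \<epsilon> f\<close>. Total space and base are thus treated by
  the same lemmas.\<close>

lemma map_of_maps_borel:
  assumes G: "group G" and H: "group H" and \<phi>: "\<phi> \<in> hom G H"
    and EH: "G_space H T EH aEH" and Y: "G_space H T Y aY"
    and \<epsilon>: "equivariant_map G \<phi> EG aEG EH aEH \<epsilon>" and f: "equivariant_map G \<phi> X aX Y aY f"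
  shows "map_of_maps
    (borel_construction G EG aEG X aX) (orbit_space G EG aEG) borel_projection
    (borel_construction H EH aEH Y aY) (orbit_space H EH aEH) borel_projection
    (classifying_map H (\<lambda>h. map_prod (aEH h) (aY h)) (map_prod \<epsilon> f)) (classifying_map H aEH \<epsilon>)"
proof
  let ?a = "\<lambda>g. map_prod (aEG g) (aX g)" and ?b = "\<lambda>h. map_prod (aEH h) (aY h)"
  have prod: "equivariant_map G \<phi> (prod_topology EG X) ?a (prod_topology EH Y) ?b (map_prod \<epsilon> f)"
    using \<epsilon> f
    unfolding equivariant_map_def map_prod_def by (auto simp only: continuous_map_prod_top) auto
  have orbit_EH: "orbit H aEH (aEH h y) = orbit H aEH y"
    if "h \<in> carrier H" "y \<in> topspace EH" for h y
    using that by (intro orbit_translate[OF H] G_space_mult[OF EH])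
  have orbit_prod: "orbit H ?b (map_prod (aEH h) (aY h) y) = orbit H ?b y"
    if "h \<in> carrier H" "y \<in> topspace (prod_topology EH Y)" for h y
    by (rule orbit_diagonal_translate[OF H EH Y that])
  show "continuous_map (borel_construction G EG aEG X aX) (orbit_space G EG aEG) borel_projection"
    and "continuous_map (borel_construction H EH aEH Y aY) (orbit_space H EH aEH) borel_projection"
    by (rule continuous_map_borel_projection)+
  show "continuous_map (borel_construction G EG aEG X aX) (borel_construction H EH aEH Y aY)
      (classifying_map H ?b (map_prod \<epsilon> f))"
    unfolding borel_construction_def
    by (rule continuous_map_classifying_map[OF G \<phi> prod orbit_prod])
  show "continuous_map (orbit_space G EG aEG) (orbit_space H EH aEH) (classifying_map H aEH \<epsilon>)"
    by (rule continuous_map_classifying_map[OF G \<phi> \<epsilon> orbit_EH])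
  fix c assume "c \<in> topspace (borel_construction G EG aEG X aX)"
  then obtain z where z: "z \<in> topspace (prod_topology EG X)" and c: "c = orbit G ?a z"
    using quotient_imp_surjective_map[OF quotient_map_orbit_space[of "prod_topology EG X" G ?a]]
    unfolding borel_construction_def by blast
  \<comment> \<open>Both ways round the square send the orbit of \<open>z\<close> to the orbit of
    \<open>\<epsilon> (fst z)\<close>.\<close>
  have "classifying_map H ?b (map_prod \<epsilon> f) (orbit G ?a z) = orbit H ?b (map_prod \<epsilon> f z)"
    by (rule classifying_map_orbit[OF G \<phi> prod orbit_prod z])
  moreover have "classifying_map H aEH \<epsilon> (orbit G aEG (fst z)) = orbit H aEH (\<epsilon> (fst z))"
    by (rule classifying_map_orbit[OF G \<phi> \<epsilon> orbit_EH]) (use z in auto)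
  ultimately show "borel_projection (classifying_map H ?b (map_prod \<epsilon> f) c) =
      classifying_map H aEH \<epsilon> (borel_projection c)"
    by (simp add: c borel_projection_orbit)
qed

theorem corollary4p4:
  fixes G :: "'g monoid" and TG :: "'g topology"
    and H :: "'h monoid" and TH :: "'h topology"
    and \<phi> :: "'g \<Rightarrow> 'h"
    and X :: "'x topology" and aX :: "'g \<Rightarrow> 'x \<Rightarrow> 'x"
    and Y :: "'y topology" and aY :: "'h \<Rightarrow> 'y \<Rightarrow> 'y"
    and EG :: "'e topology" and aEG :: "'g \<Rightarrow> 'e \<Rightarrow> 'e"
    and EH :: "'f topology" and aEH :: "'h \<Rightarrow> 'f \<Rightarrow> 'f"
    and E\<phi> :: "'e \<Rightarrow> 'f"
  assumes "compact_lie_group G TG" and "compact_lie_group H TH"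
    and "\<phi> \<in> hom G H" and "continuous_map TG TH \<phi>"
    and "G_space G TG X aX" and "path_connected_space X"
    and "G_space H TH Y aY" and "path_connected_space Y"
    and "universal_space G TG EG aEG" and "universal_space H TH EH aEH"
    and "equivariant_map G \<phi> EG aEG EH aEH E\<phi>"
    and "\<exists>r::enat. 2 \<le> r \<and>
           (index_obstructions r G EG aEG X aX H EH aEH Y aY E\<phi>
              :: ('f set, 'r::{comm_ring, monoid_mult}) total_class set) \<noteq> {}"
  shows "\<nexists>f. equivariant_map G \<phi> X aX Y aY f"
proof
  assume "\<exists>f. equivariant_map G \<phi> X aX Y aY f"
  then obtain f where f: "equivariant_map G \<phi> X aX Y aY f" ..
  obtain r :: enat and l :: "('f set, 'r) total_class"
    where r: "2 \<le> r" and l: "l \<in> partial_borel_index r H EH aEH Y aY"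
      and not: "induced_hom (orbit_space G EG aEG) (classifying_map H aEH E\<phi>) l
        \<notin> partial_borel_index r G EG aEG X aX"
    using assms(12) by (auto simp: index_obstructions_def)
  have "group G" and "group H"
    using assms(1,2) by (simp_all add: compact_lie_group_def)
  moreover have "G_space H TH EH aEH"
    using assms(10) by (simp add: universal_space_def)
  \<comment> \<open>The hypothetical \<open>f\<close> enters only the map of total spaces. The base
    map depends on \<open>E\<phi>\<close> alone and is the one in \<open>index_obstructions\<close>,
    so the conclusion contradicts \<open>not\<close> literally.\<close>
  ultimately interpret map_of_maps
    "borel_construction G EG aEG X aX" "orbit_space G EG aEG" borel_projection
    "borel_construction H EH aEH Y aY" "orbit_space H EH aEH" borel_projection
    "classifying_map H (\<lambda>h. map_prod (aEH h) (aY h)) (map_prod E\<phi> f)" "classifying_map H aEH E\<phi>"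
    using assms(3,7,11) f by (intro map_of_maps_borel)
  have l_total: "l \<in> total_cohomology (orbit_space H EH aEH)"
    using l by (simp add: partial_borel_index_def)
  then have "l n \<in> cohomology n (orbit_space H EH aEH)" for n
    by (simp add: total_cohomology_def)
  then have "induced_hom (orbit_space G EG aEG) (classifying_map H aEH E\<phi>) l
      \<in> partial_borel_index r G EG aEG X aX"
    using l by (simp add: partial_borel_index_def edge_hom_induced_hom_eq_zero[OF r]
        induced_hom_total_cohomology[OF cont_\<beta> l_total])
  then show False
    using not by contradiction
qed

end
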